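(* Let $R$ be an integral domain and let $S\subseteq R$ be a multiplicatively closed subset. If every ideal of $R$ that is not an $S$-radical ideal is $S$-finite, then $R$ is an $S$-Noetherian ring.
   Context: A multiplicatively closed subset $S$ of a commutative ring $R$ is a subset with $1\in S$, $0\notin S$, and $st\in S$ for all $s,t\in S$. For an ideal $I$ of $R$, the $S$-radical of $I$ is $\sqrt[S]{I}=\{a\in R\mid sa^n\in I \text{ for some } s\in S \text{ and some positive integer } n\}$. The ideal $I$ is an $S$-radical ideal if $\sqrt[S]{I}=I$. An ideal $I$ of $R$ is $S$-finite if there exist $s\in S$ and a finitely generated ideal $J$ of $R$ such that $sI\subseteq J\subseteq I$. The ring $R$ is $S$-Noetherian if every ideal of $R$ is $S$-finite. *)

theory Defs
  imports "HOL-Algebra.Ideal"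
begin

definition mult_closed_subset :: "('a, 'b) ring_scheme \<Rightarrow> 'a set \<Rightarrow> bool" where
  "mult_closed_subset R S \<longleftrightarrow> submonoid S R \<and> \<zero>\<^bsub>R\<^esub> \<notin> S"

definition S_radical :: "('a, 'b) ring_scheme \<Rightarrow> 'a set \<Rightarrow> 'a set \<Rightarrow> 'a set" where
  "S_radical R S I =
    {a \<in> carrier R. \<exists>s\<in>S. \<exists>n::nat. n > 0 \<and> s \<otimes>\<^bsub>R\<^esub> a [^]\<^bsub>R\<^esub> n \<in> I}"

definition S_radical_ideal :: "('a, 'b) ring_scheme \<Rightarrow> 'a set \<Rightarrow> 'a set \<Rightarrow> bool" where
  "S_radical_ideal R S I \<longleftrightarrow> ideal I R \<and> S_radical R S I = I"

definition fin_gen_ideal :: "('a, 'b) ring_scheme \<Rightarrow> 'a set \<Rightarrow> bool" where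
  "fin_gen_ideal R J \<longleftrightarrow> (\<exists>A\<subseteq>carrier R. finite A \<and> J = Idl\<^bsub>R\<^esub> A)"

(* The set sI = {s x | x in I} is the left coset of I in the multiplicative monoid of R. *)
definition S_finite_ideal :: "('a, 'b) ring_scheme \<Rightarrow> 'a set \<Rightarrow> 'a set \<Rightarrow> bool" where
  "S_finite_ideal R S I \<longleftrightarrow> ideal I R \<and>
    (\<exists>s\<in>S. \<exists>J. fin_gen_ideal R J \<and> s <#\<^bsub>R\<^esub> I \<subseteq> J \<and> J \<subseteq> I)"

definition S_noetherian :: "('a, 'b) ring_scheme \<Rightarrow> 'a set \<Rightarrow> bool" where
  "S_noetherian R S \<longleftrightarrow> cring R \<and> (\<forall>I. ideal I R \<longrightarrow> S_finite_ideal R S I)"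

end

theory Submission
  imports Defs
begin

text \<open>
  The idea is to multiply a nonzero ideal \<open>I\<close> by one of its own nonzero elements \<open>a\<close>.
  As \<open>a\<^sup>2 \<in> aI\<close>, the element \<open>a\<close> always lies in the \<open>S\<close>-radical of \<open>aI\<close>; so if \<open>aI\<close> is an
  \<open>S\<close>-radical ideal, then \<open>a \<in> aI\<close>, and cancelling \<open>a\<close> gives \<open>\<one> \<in> I\<close>
  (\<open>S_radical_multiple_imp_one_mem\<close>), so \<open>I\<close> is the whole ring, generated by \<open>\<one>\<close>.  Otherwise the
  hypothesis applies to \<open>aI\<close>, and since multiplication by \<open>a\<close> is an isomorphism of modules from
  \<open>I\<close> onto \<open>aI\<close>, \<open>S\<close>-finiteness of \<open>aI\<close> passes to \<open>I\<close> (\<open>S_finite_ideal_cancel\<close>).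
\<close>

lemma mem_l_coset_iff: "y \<in> a <#\<^bsub>G\<^esub> H \<longleftrightarrow> (\<exists>h\<in>H. y = a \<otimes>\<^bsub>G\<^esub> h)"
  by (auto simp: l_coset_def)

lemma (in cring) ideal_l_coset:
  assumes I: "ideal I R" and a: "a \<in> carrier R"
  shows "ideal (a <# I) R"
proof -
  interpret I: ideal I R by (rule I)
  have sub: "I \<subseteq> carrier R"
    by (rule I.a_subset)
  show ?thesis
  proof (rule idealI)
    show "ring R" ..
    show "subgroup (a <# I) (add_monoid R)"
    proof (rule add.subgroupI)
      show "a <# I \<subseteq> carrier R"
        using a sub by (auto simp: mem_l_coset_iff)
      show "a <# I \<noteq> {}"
        unfolding l_coset_def using I.zero_closed by blast
      show "\<ominus> y \<in> a <# I" if y: "y \<in> a <# I" for y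
      proof -
        obtain x where x: "x \<in> I" "y = a \<otimes> x"
          using y by (auto simp: mem_l_coset_iff)
        then have "\<ominus> y = a \<otimes> (\<ominus> x)"
          using a sub by (auto simp: r_minus)
        then show ?thesis
          using x I.a_inv_closed by (auto simp: mem_l_coset_iff)
      qed
      show "y \<oplus> z \<in> a <# I" if yz: "y \<in> a <# I" "z \<in> a <# I" for y z
      proof -
        obtain u v where uv: "u \<in> I" "y = a \<otimes> u" "v \<in> I" "z = a \<otimes> v"
          using yz by (auto simp: mem_l_coset_iff)
        then have "y \<oplus> z = a \<otimes> (u \<oplus> v)"
          using a sub by (auto simp: r_distr)
        then show ?thesis
          using uv I.a_closed by (auto simp: mem_l_coset_iff)
      qed
    qed
    show left: "r \<otimes> y \<in> a <# I" if y: "y \<in> a <# I" and r: "r \<in> carrier R" for y r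
    proof -
      obtain x where x: "x \<in> I" "y = a \<otimes> x"
        using y by (auto simp: mem_l_coset_iff)
      then have "r \<otimes> y = a \<otimes> (r \<otimes> x)"
        using a r sub by (auto simp: m_lcomm)
      then show ?thesis
        using x r I.I_l_closed by (auto simp: mem_l_coset_iff)
    qed
    show "y \<otimes> r \<in> a <# I" if y: "y \<in> a <# I" and r: "r \<in> carrier R" for y r
    proof -
      have "y \<in> carrier R"
        using y a sub by (auto simp: mem_l_coset_iff)
      then show ?thesis
        using left[OF y r] r by (simp add: m_comm)
    qed
  qed
qed

lemma (in cring) S_finite_ideal_of_fin_gen:
  assumes S: "mult_closed_subset R S" and I: "ideal I R" and fg: "fin_gen_ideal R I"
  shows "S_finite_ideal R S I"
proof -
  have one: "\<one> \<in> S"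
    using S by (simp add: mult_closed_subset_def submonoid.one_closed)
  have sub: "I \<subseteq> carrier R"
    by (rule ideal.axioms(1)[OF I, THEN additive_subgroup.a_subset])
  have "\<one> \<otimes> x = x" if "x \<in> I" for x
    using that sub by auto
  then have "\<one> <# I \<subseteq> I"
    by (auto simp: mem_l_coset_iff)
  then show ?thesis
    unfolding S_finite_ideal_def using one I fg by blast
qed

text \<open>
  The generators of the witness \<open>J\<close> for \<open>aI\<close> are multiples \<open>ab\<close> with \<open>b \<in> I\<close>; the elements \<open>b\<close>
  generate a witness \<open>K\<close> for \<open>I\<close>, with the same multiplier \<open>s\<close>.
\<close>

lemma (in domain) S_finite_ideal_cancel:
  assumes S: "S \<subseteq> carrier R" and I: "ideal I R"
    and a: "a \<in> carrier R" "a \<noteq> \<zero>"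
    and fin: "S_finite_ideal R S (a <# I)"
  shows "S_finite_ideal R S I"
proof -
  have sub: "I \<subseteq> carrier R"
    by (rule ideal.axioms(1)[OF I, THEN additive_subgroup.a_subset])
  obtain s J A where s: "s \<in> S" and A: "A \<subseteq> carrier R" "finite A" and J: "J = Idl A"
    and lower: "s <# (a <# I) \<subseteq> J" and upper: "J \<subseteq> a <# I"
    using fin unfolding S_finite_ideal_def fin_gen_ideal_def by blast
  have "a <# I = (\<otimes>) a ` I"
    by (auto simp: mem_l_coset_iff)
  then have "A \<subseteq> (\<otimes>) a ` I"
    using genideal_self[OF A(1)] upper J by auto
  then obtain B where B: "B \<subseteq> I" "finite B" "A = (\<otimes>) a ` B"
    using finite_subset_image[OF A(2)] by meson
  define K where "K = Idl B"
  have B_carr: "B \<subseteq> carrier R"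
    using B(1) sub by blast
  have K: "ideal K R"
    unfolding K_def using B_carr by (rule genideal_ideal)
  have K_carr: "K \<subseteq> carrier R"
    by (rule ideal.axioms(1)[OF K, THEN additive_subgroup.a_subset])
  have "A \<subseteq> a <# K"
    unfolding B(3) K_def l_coset_def using genideal_self[OF B_carr] by blast
  then have J_sub: "J \<subseteq> a <# K"
    unfolding J by (rule genideal_minimal[OF ideal_l_coset[OF K a(1)]])
  have "s <# I \<subseteq> K"
  proof
    fix y assume "y \<in> s <# I"
    then obtain x where x: "x \<in> I" "y = s \<otimes> x"
      by (auto simp: mem_l_coset_iff)
    have carr: "s \<in> carrier R" "x \<in> carrier R"
      using s S x sub by auto
    have "s \<otimes> (a \<otimes> x) \<in> J"
      using lower x(1) by (auto simp: l_coset_def)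
    then obtain k where k: "k \<in> K" "s \<otimes> (a \<otimes> x) = a \<otimes> k"
      using J_sub unfolding l_coset_def by blast
    then have "a \<otimes> (s \<otimes> x) = a \<otimes> k"
      using a(1) carr by (simp add: m_lcomm)
    then have "s \<otimes> x = k"
      using a carr k(1) K_carr by (subst (asm) m_lcancel) auto
    then show "y \<in> K"
      using k x by simp
  qed
  moreover have "K \<subseteq> I"
    unfolding K_def by (rule genideal_minimal[OF I B(1)])
  moreover have "fin_gen_ideal R K"
    unfolding fin_gen_ideal_def K_def using B_carr B(2) by blast
  ultimately show ?thesis
    unfolding S_finite_ideal_def using I s by blast
qed

text \<open>
  Already \<open>a\<^sup>2 \<in> aI\<close>, with multiplier \<open>\<one> \<in> S\<close>, puts \<open>a\<close> into the \<open>S\<close>-radical of \<open>aI\<close>.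
\<close>

lemma (in domain) S_radical_multiple_imp_one_mem:
  assumes S: "mult_closed_subset R S" and I: "ideal I R"
    and a: "a \<in> I" "a \<noteq> \<zero>"
    and rad: "S_radical_ideal R S (a <# I)"
  shows "\<one> \<in> I"
proof -
  have sub: "I \<subseteq> carrier R"
    by (rule ideal.axioms(1)[OF I, THEN additive_subgroup.a_subset])
  have a_carr: "a \<in> carrier R"
    using a sub by blast
  have "\<one> \<in> S"
    using S by (simp add: mult_closed_subset_def submonoid.one_closed)
  moreover have "\<one> \<otimes> a [^] (2::nat) \<in> a <# I"
    using a a_carr by (auto simp: mem_l_coset_iff numeral_2_eq_2)
  ultimately have "a \<in> S_radical R S (a <# I)"
    unfolding S_radical_def using a_carr zero_less_numeral by blast
  then obtain i where i: "i \<in> I" "a = a \<otimes> i"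
    using rad by (auto simp: S_radical_ideal_def mem_l_coset_iff)
  then have "a \<otimes> \<one> = a \<otimes> i"
    using a_carr by simp
  then have "\<one> = i"
    using a a_carr i(1) sub by (subst (asm) m_lcancel) auto
  then show ?thesis
    using i(1) by simp
qed

theorem theorem2p24:
  fixes R :: "('a, 'b) ring_scheme" and S :: "'a set"
  assumes "domain R"
    and "mult_closed_subset R S"
    and "\<And>I. ideal I R \<Longrightarrow> \<not> S_radical_ideal R S I \<Longrightarrow> S_finite_ideal R S I"
  shows "S_noetherian R S"
proof -
  interpret domain R by (rule assms(1))
  have S: "S \<subseteq> carrier R"
    using assms(2) by (simp add: mult_closed_subset_def submonoid.subset)
  have "S_finite_ideal R S I" if I: "ideal I R" for I
  proof (cases "I = {\<zero>\<^bsub>R\<^esub>}")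
    case True
    have "fin_gen_ideal R I"
      unfolding fin_gen_ideal_def True using genideal_zero by blast
    then show ?thesis
      by (rule S_finite_ideal_of_fin_gen[OF assms(2) I])
  next
    case False
    have add: "additive_subgroup I R"
      by (rule ideal.axioms(1)[OF I])
    obtain a where a: "a \<in> I" "a \<noteq> \<zero>\<^bsub>R\<^esub>"
      using False additive_subgroup.zero_closed[OF add] by blast
    have a_carr: "a \<in> carrier R"
      using a(1) additive_subgroup.a_subset[OF add] by blast
    show ?thesis
    proof (cases "S_radical_ideal R S (a <#\<^bsub>R\<^esub> I)")
      case True
      then have "\<one>\<^bsub>R\<^esub> \<in> I"
        by (rule S_radical_multiple_imp_one_mem[OF assms(2) I a])
      then have "I = carrier R"
        by (rule ideal.one_imp_carrier[OF I])
      then have "fin_gen_ideal R I"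
        unfolding fin_gen_ideal_def using genideal_one by blast
      then show ?thesis
        by (rule S_finite_ideal_of_fin_gen[OF assms(2) I])
    next
      case False
      then have "S_finite_ideal R S (a <#\<^bsub>R\<^esub> I)"
        by (rule assms(3)[OF ideal_l_coset[OF I a_carr]])
      then show ?thesis
        by (rule S_finite_ideal_cancel[OF S I a_carr a(2)])
    qed
  qed
  then show ?thesis
    unfolding S_noetherian_def using is_cring by blast
qed

end
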